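(* There exists an absolute constant $C>0$ such that the following holds. Let $\varepsilon>0$, let $t\geq1$ be an integer, and let $n\geq 2^{Ct/\varepsilon^{16}}$. Then every locally $\varepsilon$-balanced $2$-edge-coloured (red/blue) $K_n$ contains one of the following: (i) two disjoint vertex sets $A,B$ of size $t$ such that, for some colour $c$, all edges inside $A$ and inside $B$ have colour $c$ and all edges between $A$ and $B$ have the other colour; (ii) four disjoint vertex sets $V_1,V_2,V_3,V_4$ of size $t$ such that all edges inside $V_1$, inside $V_4$, between $V_1$ and $V_3$, between $V_1$ and $V_4$, and between $V_2$ and $V_4$ are red, while all edges inside $V_2$, inside $V_3$, between $V_1$ and $V_2$, between $V_2$ and $V_3$, and between $V_3$ and $V_4$ are blue.
   Context: A $2$-edge-coloured $K_n$ is called locally $\varepsilon$-balanced if every vertex is incident to at least $\varepsilon n$ red edges and at least $\varepsilon n$ blue edges. *)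

theory Defs
  imports Complex_Main
begin

text \<open>A 2-edge-colouring of K_n on vertex set {..<n}: col x y = True means the edge xy is red,
  False means blue. Only values for distinct x y in {..<n} matter; symmetry is required.\<close>

definition colouring :: "nat \<Rightarrow> (nat \<Rightarrow> nat \<Rightarrow> bool) \<Rightarrow> bool" where
  "colouring n col \<longleftrightarrow> (\<forall>x<n. \<forall>y<n. col x y = col y x)"

definition red_deg :: "nat \<Rightarrow> (nat \<Rightarrow> nat \<Rightarrow> bool) \<Rightarrow> nat \<Rightarrow> nat" where
  "red_deg n col v = card {u. u < n \<and> u \<noteq> v \<and> col v u}"

definition blue_deg :: "nat \<Rightarrow> (nat \<Rightarrow> nat \<Rightarrow> bool) \<Rightarrow> nat \<Rightarrow> nat" where
  "blue_deg n col v = card {u. u < n \<and> u \<noteq> v \<and> \<not> col v u}"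

definition locally_balanced :: "real \<Rightarrow> nat \<Rightarrow> (nat \<Rightarrow> nat \<Rightarrow> bool) \<Rightarrow> bool" where
  "locally_balanced \<epsilon> n col \<longleftrightarrow>
     (\<forall>v<n. real (red_deg n col v) \<ge> \<epsilon> * real n \<and> real (blue_deg n col v) \<ge> \<epsilon> * real n)"

definition mono_in :: "(nat \<Rightarrow> nat \<Rightarrow> bool) \<Rightarrow> bool \<Rightarrow> nat set \<Rightarrow> bool" where
  "mono_in col c A \<longleftrightarrow> (\<forall>x\<in>A. \<forall>y\<in>A. x \<noteq> y \<longrightarrow> col x y = c)"

definition mono_btw :: "(nat \<Rightarrow> nat \<Rightarrow> bool) \<Rightarrow> bool \<Rightarrow> nat set \<Rightarrow> nat set \<Rightarrow> bool" where
  "mono_btw col c A B \<longleftrightarrow> (\<forall>x\<in>A. \<forall>y\<in>B. col x y = c)"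

end

theory Submission
  imports Defs
begin

text \<open>Split the vertices into \<open>R\<close> and \<open>B\<close> such that every large subset of \<open>R\<close> contains a red
  \<open>m\<close>-clique and every large subset of \<open>B\<close> a blue one. If a red clique in \<open>R\<close> sent many blue edges
  to \<open>R\<close>, then pigeonholing over the \<open>2 ^ m\<close> possible neighbourhoods would give many vertices of
  \<open>R\<close> that are blue to the same large part of it; these contain a red clique, which is alternative
  (i). So \<open>R\<close> is almost completely red, \<open>B\<close> almost completely blue, and by local balance almost
  every vertex of \<open>R\<close> has many blue neighbours in \<open>B\<close>, and vice versa. The bipartite red graph
  between \<open>R\<close> and \<open>B\<close> is then far from having nested neighbourhoods, so it has many induced
  matchings of size two. Blowing up their four vertices one at a time, with a new pigeonholing over
  neighbourhoods in each step, gives alternative (ii). The clique part kept shrinks by a factor of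
  order \<open>\<epsilon>\<^sup>2\<close> in each of three steps, so \<open>m\<close> of order \<open>t / \<epsilon> ^ 6\<close> suffices.\<close>

section \<open>Monochromatic cliques in large sets\<close>

definition has_clique :: "(nat \<Rightarrow> nat \<Rightarrow> bool) \<Rightarrow> bool \<Rightarrow> nat \<Rightarrow> nat set \<Rightarrow> bool" where
  "has_clique col c m S \<longleftrightarrow> (\<exists>K\<subseteq>S. card K = m \<and> mono_in col c K)"

definition rich :: "(nat \<Rightarrow> nat \<Rightarrow> bool) \<Rightarrow> bool \<Rightarrow> nat \<Rightarrow> nat \<Rightarrow> nat set \<Rightarrow> bool" where
  "rich col c m M R \<longleftrightarrow> (\<forall>S\<subseteq>R. M \<le> card S \<longrightarrow> has_clique col c m S)"

text \<open>Alternative (i) with the colour as a parameter, so that one argument can exclude it in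
  \<open>R\<close> with red and in \<open>B\<close> with blue cliques.\<close>

definition opposite_cliques :: "nat \<Rightarrow> (nat \<Rightarrow> nat \<Rightarrow> bool) \<Rightarrow> bool \<Rightarrow> nat \<Rightarrow> bool" where
  "opposite_cliques n col c t \<longleftrightarrow>
     (\<exists>A B. A \<subseteq> {..<n} \<and> B \<subseteq> {..<n} \<and> A \<inter> B = {} \<and> card A = t \<and> card B = t \<and>
        mono_in col c A \<and> mono_in col c B \<and> mono_btw col (\<not> c) A B)"

lemma mono_in_subset: "mono_in col c A \<Longrightarrow> B \<subseteq> A \<Longrightarrow> mono_in col c B"
  unfolding mono_in_def by blast

lemma has_clique_mono: "has_clique col c m S \<Longrightarrow> S \<subseteq> T \<Longrightarrow> has_clique col c m T"
  unfolding has_clique_def by blast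

lemma rich_subset: "rich col c m M R \<Longrightarrow> S \<subseteq> R \<Longrightarrow> rich col c m M S"
  unfolding rich_def by blast

section \<open>Ramsey bound and partition into rich parts\<close>

text \<open>The Erdos-Szekeres argument with a crude bound: one of the two colour neighbourhoods of
  any vertex \<open>v\<close> keeps half of the required size, and \<open>v\<close> extends a clique
  of its own colour found there.\<close>

lemma ramsey_bound:
  assumes "finite S" "2 ^ (a + b) \<le> card S" "\<And>x y. x \<in> S \<Longrightarrow> y \<in> S \<Longrightarrow> col x y = col y x"
  shows "has_clique col True a S \<or> has_clique col False b S"
  using assms
proof (induction "a + b" arbitrary: a b S)
  case 0
  then show ?case by (auto simp: has_clique_def mono_in_def intro!: exI[of _ "{}"])
next
  case (Suc k)
  show ?case
  proof (cases "a = 0 \<or> b = 0")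
    case True
    then show ?thesis by (auto simp: has_clique_def mono_in_def intro!: exI[of _ "{}"])
  next
    case False
    then obtain a' b' where ab: "a = Suc a'" "b = Suc b'" by (meson not0_implies_Suc)
    have "S \<noteq> {}" using Suc.prems(2) by auto
    then obtain v where v: "v \<in> S" by blast
    define X where "X = {u \<in> S - {v}. col v u}"
    define Y where "Y = {u \<in> S - {v}. \<not> col v u}"
    have XY: "X \<union> Y = S - {v}" "X \<inter> Y = {}" "finite X" "finite Y" "X \<subseteq> S" "Y \<subseteq> S"
      using Suc.prems(1) by (auto simp: X_def Y_def)
    have "card X + card Y = card S - 1"
      using card_Un_disjoint[OF XY(3,4,2)] XY(1) v Suc.prems(1) by simp
    moreover have "card S \<ge> 2 * 2 ^ k" using Suc.prems(2) Suc.hyps(2) by (metis power_Suc)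
    \<comment> \<open>Losing \<open>v\<close> itself is harmless: two sets of size below
      \<open>2 ^ k\<close> have at most \<open>2 * 2 ^ k - 2\<close> elements together.\<close>
    ultimately have "2 ^ k \<le> card X \<or> 2 ^ k \<le> card Y" by linarith
    then show ?thesis
    proof
      assume *: "2 ^ k \<le> card X"
      have k: "k = a' + b" using Suc.hyps(2) ab by simp
      have "has_clique col True a' X \<or> has_clique col False b X"
      proof (rule Suc.hyps(1)[OF k XY(3)])
        show "2 ^ (a' + b) \<le> card X" using * k by simp
        show "col x y = col y x" if "x \<in> X" "y \<in> X" for x y
          using Suc.prems(3)[of x y] that XY(5) by blast
      qed
      then show ?thesis
      proof
        assume "has_clique col True a' X"
        then obtain K where K: "K \<subseteq> X" "card K = a'" "mono_in col True K"
          by (auto simp: has_clique_def)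
        have "finite K" "v \<notin> K" using K(1) finite_subset[OF K(1) XY(3)] by (auto simp: X_def)
        moreover have "col v u \<and> col u v" if "u \<in> K" for u
          using that K(1) Suc.prems(3)[of u v] v by (auto simp: X_def)
        then have "mono_in col True (insert v K)" using K(3) by (auto simp: mono_in_def)
        ultimately show ?thesis unfolding has_clique_def ab
          using K XY v by (intro disjI1 exI[of _ "insert v K"]) auto
      qed (use has_clique_mono XY in blast)
    next
      assume *: "2 ^ k \<le> card Y"
      have k: "k = a + b'" using Suc.hyps(2) ab by simp
      have "has_clique col True a Y \<or> has_clique col False b' Y"
      proof (rule Suc.hyps(1)[OF k XY(4)])
        show "2 ^ (a + b') \<le> card Y" using * k by simp
        show "col x y = col y x" if "x \<in> Y" "y \<in> Y" for x y
          using Suc.prems(3)[of x y] that XY(6) by blast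
      qed
      then show ?thesis
      proof
        assume "has_clique col False b' Y"
        then obtain K where K: "K \<subseteq> Y" "card K = b'" "mono_in col False K"
          by (auto simp: has_clique_def)
        have "finite K" "v \<notin> K" using K(1) finite_subset[OF K(1) XY(4)] by (auto simp: Y_def)
        moreover have "\<not> col v u \<and> \<not> col u v" if "u \<in> K" for u
          using that K(1) Suc.prems(3)[of u v] v by (auto simp: Y_def)
        then have "mono_in col False (insert v K)" using K(3) by (auto simp: mono_in_def)
        ultimately show ?thesis unfolding has_clique_def ab
          using K XY v by (intro disjI2 exI[of _ "insert v K"]) auto
      qed (use has_clique_mono XY in blast)
    qed
  qed
qed

text \<open>The set \<open>B\<close> is a largest set whose blue-richness threshold grows only proportionally to its
  size; a big set disjoint from \<open>B\<close> without red clique would be very blue-rich and could be added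
  to \<open>B\<close>.\<close>

lemma rich_partition:
  assumes fin: "finite V" and sym: "\<And>x y. x \<in> V \<Longrightarrow> y \<in> V \<Longrightarrow> col x y = col y x"
    and M: "1 \<le> M" "M + card V * 4 ^ m \<le> M * M"
  obtains R B where "V = R \<union> B" "R \<inter> B = {}" "rich col True m M R" "rich col False m M B"
proof -
  \<comment> \<open>The threshold for \<open>card S\<close> is
    \<open>1 + card B * 4 ^ m / M\<close>, multiplied by \<open>M\<close> to stay in the naturals.
    By the second assumption in \<open>M\<close> it never exceeds \<open>M\<close>, whatever
    \<open>B\<close> is.\<close>
  define \<Phi> where "\<Phi> B \<longleftrightarrow> B \<subseteq> V \<and>
    (\<forall>S\<subseteq>B. M + card B * 4 ^ m \<le> card S * M \<longrightarrow> has_clique col False m S)" for B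
  have "\<Phi> {}" using M by (auto simp: \<Phi>_def)
  moreover have "\<forall>B. \<Phi> B \<longrightarrow> card B < Suc (card V)"
    using card_mono[OF fin] by (auto simp: \<Phi>_def less_Suc_eq_le)
  ultimately obtain B where B: "\<Phi> B" "\<And>B'. \<Phi> B' \<Longrightarrow> card B' \<le> card B"
    using ex_has_greatest_nat[of \<Phi> "{}" card "Suc (card V)"] by (metis less_imp_le)
  have BV: "B \<subseteq> V" and finB: "finite B" using B fin finite_subset by (auto simp: \<Phi>_def)
  have "rich col False m M B"
    unfolding rich_def
  proof (intro allI impI)
    fix S assume S: "S \<subseteq> B" "M \<le> card S"
    have "M + card B * 4 ^ m \<le> M + card V * 4 ^ m" using card_mono[OF fin BV] by simp
    also have "\<dots> \<le> M * M" by (rule M)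
    also have "\<dots> \<le> card S * M" using S by simp
    finally show "has_clique col False m S" using B S by (simp add: \<Phi>_def)
  qed
  moreover have "rich col True m M (V - B)"
    unfolding rich_def
  proof (intro allI impI, rule ccontr)
    fix S assume S: "S \<subseteq> V - B" "M \<le> card S" and no: "\<not> has_clique col True m S"
    have finS: "finite S" using S fin finite_subset by blast
    have cU: "card (B \<union> S) = card B + card S"
      using S finS finB by (intro card_Un_disjoint) auto
    have "\<Phi> (B \<union> S)"
      unfolding \<Phi>_def
    proof (intro conjI allI impI)
      fix T assume T: "T \<subseteq> B \<union> S" "M + card (B \<union> S) * 4 ^ m \<le> card T * M"
      have "T = (T \<inter> S) \<union> (T \<inter> B)" "(T \<inter> S) \<inter> (T \<inter> B) = {}" using T S by auto
      then have cT: "card T = card (T \<inter> S) + card (T \<inter> B)"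
        using finS finB by (metis card_Un_disjoint finite_Int)
      show "has_clique col False m T"
      \<comment> \<open>If \<open>T\<close> meets \<open>S\<close> in many vertices, Ramsey gives a
        blue clique there, since \<open>S\<close> has no red one. Otherwise \<open>T\<close> loses
        fewer than \<open>4 ^ m\<close> vertices on passing to \<open>B\<close>, and the threshold
        drops by \<open>card S * 4 ^ m / M\<close>, which is at least \<open>4 ^ m\<close>.\<close>
      proof (cases "4 ^ m \<le> card (T \<inter> S)")
        case True
        have "(2::nat) ^ (m + m) = 4 ^ m" by (simp add: power_add flip: power_mult_distrib)
        then have "has_clique col True m (T \<inter> S) \<or> has_clique col False m (T \<inter> S)"
          using ramsey_bound[of "T \<inter> S" m m col] finS True S sym by auto
        then show ?thesis using no has_clique_mono by blast
      next
        case False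
        have "card (T \<inter> S) * M \<le> 4 ^ m * card S" using False S by (intro mult_mono) auto
        then have "M + card B * 4 ^ m \<le> card (T \<inter> B) * M"
          using T(2) unfolding cU cT by (simp add: algebra_simps)
        then have "has_clique col False m (T \<inter> B)" using B by (simp add: \<Phi>_def)
        then show ?thesis using has_clique_mono by blast
      qed
    qed (use S BV in auto)
    then have "card B + card S \<le> card B" using B(2) cU by metis
    then show False using S M by simp
  qed
  ultimately show ?thesis using that[of "V - B" B] BV by auto
qed

section \<open>Double counting and common neighbourhoods\<close>

text \<open>Counts the pairs satisfying \<open>P\<close> from both sides: an \<open>x\<close> of
  degree below \<open>b\<close> contributes at most \<open>b\<close>, any other at most
  \<open>card Z\<close>.\<close>

lemma double_count:
  fixes a b :: real
  assumes "finite X" "finite Z" "0 \<le> b" "\<And>z. z \<in> Z \<Longrightarrow> a \<le> card {x\<in>X. P z x}"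
  shows "a * card Z \<le> b * card X + card Z * card {x\<in>X. b \<le> card {z\<in>Z. P z x}}"
proof -
  let ?Y = "{x\<in>X. b \<le> card {z\<in>Z. P z x}}"
  have "a * card Z = (\<Sum>z\<in>Z. a)" by simp
  also have "\<dots> \<le> (\<Sum>z\<in>Z. real (card {x\<in>X. P z x}))" using assms by (intro sum_mono) auto
  also have "\<dots> = (\<Sum>x\<in>X. real (card {z\<in>Z. P z x}))"
    using sum_multicount_gen[of Z X P "\<lambda>x. card {z\<in>Z. P z x}"] assms
    by (simp flip: of_nat_sum)
  also have "\<dots> \<le> (\<Sum>x\<in>X. b + (if x \<in> ?Y then real (card Z) else 0))"
  proof (intro sum_mono)
    fix x assume "x \<in> X"
    have "card {z\<in>Z. P z x} \<le> card Z" using assms by (intro card_mono) auto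
    then show "real (card {z\<in>Z. P z x}) \<le> b + (if x \<in> ?Y then real (card Z) else 0)"
      using \<open>x \<in> X\<close> assms(3) by auto
  qed
  also have "\<dots> = b * card X + card Z * card ?Y"
    using assms(1) by (simp add: sum.distrib sum.If_cases Int_def mult.commute)
  finally show ?thesis .
qed

text \<open>By double counting, at least \<open>c * N / 2\<close> elements of \<open>X\<close> are
  related to a \<open>c / 2\<close> fraction of \<open>K\<close>. Pigeonholing them by their exact
  trace on \<open>K\<close> yields a popular trace \<open>I\<close>.\<close>

lemma common_neighbours:
  fixes c N :: real
  assumes fin: "finite K" "finite X" and K: "K \<noteq> {}" and XN: "card X \<le> N"
    and c: "0 < c" and N: "0 < N"
    and deg: "\<And>i. i \<in> K \<Longrightarrow> c * N \<le> card {x\<in>X. P i x}"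
  obtains I where "I \<subseteq> K" "c * card K / 2 \<le> card I"
    "c * N \<le> 2 ^ (card K + 1) * card {x\<in>X. \<forall>i\<in>I. P i x}"
proof -
  define \<nu> where "\<nu> x = {i\<in>K. P i x}" for x
  define Y where "Y = {x\<in>X. c * card K / 2 \<le> card (\<nu> x)}"
  have finY: "finite Y" using fin by (simp add: Y_def)
  have K0: "card K > 0" using K fin by (simp add: card_gt_0_iff)
  have "c * N * card K \<le> c * card K / 2 * card X + card K * card Y"
    using double_count[of X K "c * card K / 2" "c * N" P] fin c deg by (simp add: Y_def \<nu>_def)
  also have "\<dots> \<le> c * card K / 2 * N + card K * card Y"
    using XN c by (intro add_right_mono mult_left_mono) auto
  finally have "card K * (c * N / 2) \<le> card K * real (card Y)" by (simp add: algebra_simps)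
  then have Y: "c * N / 2 \<le> card Y" using K0 by simp
  have "\<exists>I\<in>Pow K. c * N \<le> 2 ^ (card K + 1) * card {x\<in>Y. \<nu> x = I}"
  proof (rule ccontr)
    assume *: "\<not> ?thesis"
    have "card Y = (\<Sum>I\<in>Pow K. card {x\<in>Y. \<nu> x = I})"
      using sum.group[OF finY, of "Pow K" \<nu> "\<lambda>_. 1::nat"] fin by (simp add: \<nu>_def image_subset_iff)
    then have "2 ^ (card K + 1) * real (card Y) = (\<Sum>I\<in>Pow K. 2 ^ (card K + 1) * real (card {x\<in>Y. \<nu> x = I}))"
      by (simp add: sum_distrib_left)
    also have "\<dots> < (\<Sum>I\<in>Pow K. c * N)" using * fin by (intro sum_strict_mono) (auto simp: not_le)
    also have "\<dots> = 2 ^ card K * (c * N)" using fin by (simp add: card_Pow)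
    finally have "2 ^ card K * (2 * real (card Y)) < 2 ^ card K * (c * N)" by (simp add: mult_ac)
    then show False using Y by simp
  qed
  then obtain I where I: "I \<subseteq> K" "c * N \<le> 2 ^ (card K + 1) * card {x\<in>Y. \<nu> x = I}" by auto
  \<comment> \<open>The lower bound on \<open>card I\<close> is read off from an element of
    \<open>Y\<close> with trace \<open>I\<close>, so one must exist.\<close>
  have "{x\<in>Y. \<nu> x = I} \<noteq> {}"
  proof
    assume "{x\<in>Y. \<nu> x = I} = {}"
    with I(2) have "c * N \<le> 0" by (simp only: card.empty of_nat_0 mult_zero_right)
    then show False using c N by (simp add: mult_le_0_iff)
  qed
  then have "c * card K / 2 \<le> card I" by (auto simp: Y_def)
  moreover have "card {x\<in>Y. \<nu> x = I} \<le> card {x\<in>X. \<forall>i\<in>I. P i x}"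
    using fin by (intro card_mono) (auto simp: Y_def \<nu>_def)
  then have "2 ^ (card K + 1) * real (card {x\<in>Y. \<nu> x = I}) \<le> 2 ^ (card K + 1) * real (card {x\<in>X. \<forall>i\<in>I. P i x})"
    by (intro mult_left_mono) auto
  with I(2) have "c * N \<le> 2 ^ (card K + 1) * card {x\<in>X. \<forall>i\<in>I. P i x}"
    unfolding of_nat_mult of_nat_power of_nat_numeral by linarith
  ultimately show ?thesis using that[OF I(1)] by blast
qed

text \<open>The blow-up step used throughout: the common neighbourhood of \<open>I\<close> has at
  least \<open>M\<close> elements, so richness puts a clique into it. \<open>P\<close> is arbitrary,
  so that it may also involve vertices attached to \<open>i\<close>; \<open>card K\<close> may be
  below \<open>m\<close>, since later index sets have already shrunk.\<close>

lemma rich_extension: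
  fixes c \<delta> :: real
  assumes "K \<noteq> {}" "finite K" "card K \<le> m" "X \<subseteq> {..<n}" "rich col d m M X" "1 \<le> M"
    and \<delta>: "0 < \<delta>" "\<delta> \<le> c" "2 ^ (m + 1) * real M \<le> \<delta> * n"
    and deg: "\<And>i. i \<in> K \<Longrightarrow> c * n \<le> card {x\<in>X. P i x}"
  obtains I L where "I \<subseteq> K" "c * card K / 2 \<le> card I" "L \<subseteq> X" "card L = m" "mono_in col d L"
    "\<And>i x. i \<in> I \<Longrightarrow> x \<in> L \<Longrightarrow> P i x"
proof -
  have finX: "finite X" using assms finite_subset by blast
  have Xn: "card X \<le> n" using card_mono[of "{..<n}" X] assms by simp
  have "0 < 2 ^ (m + 1) * real M" using assms by simp
  then have n: "0 < real n" using \<delta> by (cases n) auto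
  obtain I where I: "I \<subseteq> K" "c * card K / 2 \<le> card I"
    "c * n \<le> 2 ^ (card K + 1) * card {x\<in>X. \<forall>i\<in>I. P i x}"
    using common_neighbours[of K X "real n" c P] assms finX Xn n by auto
  let ?S = "{x\<in>X. \<forall>i\<in>I. P i x}"
  have "2 ^ (m + 1) * real M \<le> c * n"
    using \<delta> n by (meson mult_right_mono order_trans less_imp_le)
  also have "\<dots> \<le> 2 ^ (card K + 1) * card ?S" by (rule I)
  also have "\<dots> \<le> 2 ^ (m + 1) * real (card ?S)"
    using assms by (simp del: power_Suc) (intro mult_right_mono power_increasing; simp)
  finally have "M \<le> card ?S" by simp
  then have "has_clique col d m ?S" using assms by (auto simp: rich_def)
  then obtain L where "L \<subseteq> ?S" "card L = m" "mono_in col d L" by (auto simp: has_clique_def)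
  then show ?thesis using that[of I L] I by blast
qed

section \<open>Nearly monochromatic parts and the degrees between them\<close>

text \<open>If there were \<open>M\<close> exceptional vertices, they would contain a clique of
  colour \<open>c\<close>, and \<open>rich_extension\<close> would join a large part of it in the
  opposite colour to a second such clique in \<open>R\<close>.\<close>

lemma few_exceptional:
  fixes \<delta> :: real
  assumes R: "R \<subseteq> {..<n}" "rich col c m M R" and M: "1 \<le> M" and m: "1 \<le> t" "t \<le> \<delta> * m / 2" "t \<le> m"
    and \<delta>: "0 < \<delta>" "2 ^ (m + 1) * real M \<le> \<delta> * n"
    and no: "\<not> opposite_cliques n col c t"
  shows "card {r\<in>R. \<delta> * n < card {x\<in>R. x \<noteq> r \<and> col r x = (\<not> c)}} < M"
proof (rule ccontr)
  let ?E = "{r\<in>R. \<delta> * n < card {x\<in>R. x \<noteq> r \<and> col r x = (\<not> c)}}"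
  assume "\<not> card ?E < M"
  then have "has_clique col c m ?E" using R by (auto simp: rich_def)
  then obtain K where K: "K \<subseteq> ?E" "card K = m" "mono_in col c K" by (auto simp: has_clique_def)
  have finK: "finite K" "K \<noteq> {}" using K m by (auto intro: card_ge_0_finite)
  \<comment> \<open>The conjunct \<open>x \<noteq> i\<close> makes \<open>I\<close> and
    \<open>L\<close> disjoint.\<close>
  obtain I L where IL: "I \<subseteq> K" "\<delta> * card K / 2 \<le> card I" "L \<subseteq> R" "card L = m" "mono_in col c L"
    "\<And>i x. i \<in> I \<Longrightarrow> x \<in> L \<Longrightarrow> x \<noteq> i \<and> col i x = (\<not> c)"
    by (rule rich_extension[of K m R n col c M \<delta> \<delta> "\<lambda>i x. x \<noteq> i \<and> col i x = (\<not> c)"])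
       (use K finK R M \<delta> in \<open>auto simp del: power_Suc\<close>)
  have "real t \<le> card I" using IL(2) m(2) unfolding K(2) by linarith
  then have "t \<le> card I" by simp
  then obtain A where A: "A \<subseteq> I" "card A = t" by (meson obtain_subset_with_card_n)
  obtain B where B: "B \<subseteq> L" "card B = t" using m IL by (metis obtain_subset_with_card_n)
  have "opposite_cliques n col c t"
    unfolding opposite_cliques_def
  proof (intro exI conjI)
    show "mono_in col c A" "mono_in col c B" using A B IL K mono_in_subset by blast+
    show "mono_btw col (\<not> c) A B" "A \<inter> B = {}" using A B IL(6) by (auto simp: mono_btw_def)
    show "A \<subseteq> {..<n}" "B \<subseteq> {..<n}" using A B IL(1,3) K(1) R(1) by blast+
  qed (use A B in auto)
  with no show False ..
qed

text \<open>At most \<open>\<delta> * n\<close> of the neighbours in colour \<open>c\<close> lie in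
  \<open>R\<close> and at most \<open>\<delta> * n\<close> in \<open>B - S\<close>; the rest lie in
  \<open>S\<close>.\<close>

lemma large_cross_degree:
  fixes \<epsilon> \<delta> :: real and n :: nat
  assumes "R \<union> B = {..<n}" "r \<in> R" "S \<subseteq> B"
    and deg: "\<epsilon> * n \<le> card {u. u < n \<and> u \<noteq> r \<and> col r u = c}"
    and R: "card {x\<in>R. x \<noteq> r \<and> col r x = c} \<le> \<delta> * n"
    and B: "card (B - S) \<le> \<delta> * n" and \<delta>: "4 * \<delta> \<le> \<epsilon>"
  shows "\<epsilon> / 2 * n \<le> card {x\<in>S. col r x = c}"
proof -
  let ?A = "{x\<in>R. x \<noteq> r \<and> col r x = c}" and ?D = "{x\<in>S. col r x = c}"
  have fin: "finite ?A" "finite (B - S)" "finite ?D"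
  proof -
    have "R \<subseteq> {..<n}" "B \<subseteq> {..<n}" using assms(1) by auto
    then have "finite R" "finite B" by (simp_all add: finite_subset[OF _ finite_lessThan])
    moreover from this have "finite S" using finite_subset[OF assms(3)] by simp
    ultimately show "finite ?A" "finite (B - S)" "finite ?D" by simp_all
  qed
  have "{u. u < n \<and> u \<noteq> r \<and> col r u = c} \<subseteq> ?A \<union> (B - S) \<union> ?D" using assms(1) by blast
  then have "card {u. u < n \<and> u \<noteq> r \<and> col r u = c} \<le> card (?A \<union> (B - S) \<union> ?D)"
    using fin by (intro card_mono) auto
  also have "\<dots> \<le> card ?A + card (B - S) + card ?D"
    using card_Un_le[of "?A \<union> (B - S)" ?D] card_Un_le[of ?A "B - S"] by linarith
  finally have "\<epsilon> * n \<le> \<delta> * n + \<delta> * n + card ?D" using deg R B by linarith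
  moreover have "4 * \<delta> * n \<le> \<epsilon> * n" using \<delta> by (intro mult_right_mono) auto
  ultimately show ?thesis by simp
qed

section \<open>Nearly maximal red degree and crossing neighbourhoods\<close>

text \<open>\<open>D\<close> is the \<open>M\<close>-th largest value of \<open>f\<close>, counted
  with multiplicity. With \<open>f\<close> the red degree, enough vertices reach \<open>D\<close> to
  contain a clique, while each of them is exceeded by fewer than \<open>M\<close> vertices.\<close>

lemma top_set:
  fixes f :: "'a \<Rightarrow> nat"
  assumes "finite X" "M \<le> card X" "1 \<le> M"
  obtains D where "M \<le> card {x\<in>X. D \<le> f x}" "card {x\<in>X. D < f x} < M"
proof -
  let ?P = "\<lambda>D. M \<le> card {x\<in>X. D \<le> f x}"
  have P0: "?P 0" using assms by simp
  have bound: "D \<le> Max (f ` X)" if "?P D" for D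
  proof -
    have "{x\<in>X. D \<le> f x} \<noteq> {}" using that assms by (metis card.empty not_one_le_zero le_trans)
    then obtain x where "x \<in> X" "D \<le> f x" by blast
    then show ?thesis using assms by (meson Max_ge finite_imageI image_eqI le_trans)
  qed
  define D where "D = Greatest ?P"
  have D: "?P D" "\<And>D'. ?P D' \<Longrightarrow> D' \<le> D"
    unfolding D_def using GreatestI_nat[of ?P, OF P0 bound] Greatest_le_nat[of ?P, OF _ bound] by blast+
  have "\<not> ?P (Suc D)" using D(2)[of "Suc D"] by auto
  then show ?thesis using that[of D] D(1) by (auto simp: Suc_le_eq)
qed

text \<open>A vertex \<open>v \<in> S\<close> of nearly maximal red degree into \<open>T\<close> has many blue neighbours there, and
  each of these sends many red edges back to \<open>S\<close>. So many vertices \<open>x \<in> S\<close> have many red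
  neighbours outside \<open>N v\<close>; as \<open>N x\<close> is not larger than \<open>N v\<close>, the difference is large in the
  other direction, too.\<close>

lemma many_crossing_pairs:
  fixes \<epsilon> \<delta> :: real and S T :: "nat set" and col :: "nat \<Rightarrow> nat \<Rightarrow> bool"
  defines "N \<equiv> \<lambda>r. {b\<in>T. col r b}"
  assumes S: "S \<subseteq> {..<n}" and T: "T \<subseteq> {..<n}" and v: "v \<in> S"
    and sym: "\<And>x y. x < n \<Longrightarrow> y < n \<Longrightarrow> col x y = col y x"
    and n: "0 < n" and \<epsilon>: "0 < \<epsilon>" "\<epsilon> \<le> 1" and \<delta>: "64 * \<delta> \<le> \<epsilon>\<^sup>2"
    and degv: "\<epsilon> / 2 * n \<le> card {b\<in>T. \<not> col v b}"
    and degT: "\<And>b. b \<in> T \<Longrightarrow> \<epsilon> / 2 * n \<le> card {r\<in>S. col b r}"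
    and blue: "card {x\<in>S. x \<noteq> v \<and> \<not> col v x} \<le> \<delta> * n"
    and top: "card {x\<in>S. card (N v) < card (N x)} \<le> \<delta> * n"
  shows "\<epsilon>\<^sup>2 / 16 * n \<le> card {x\<in>S. x \<noteq> v \<and> col v x \<and>
    \<epsilon>\<^sup>2 / 8 * n \<le> card (N x - N v) \<and> \<epsilon>\<^sup>2 / 8 * n \<le> card (N v - N x)}"
proof -
  have fin: "finite S" "finite T" "finite (N x)" for x
    using S T finite_subset[of _ "{..<n}"] by (auto simp: N_def)
  define Z where "Z = {b\<in>T. \<not> col v b}"
  define Y where "Y = {x\<in>S. \<epsilon>\<^sup>2 / 8 * n \<le> card (N x - N v)}"
  define G where "G = {x\<in>S. x \<noteq> v \<and> col v x \<and>
    \<epsilon>\<^sup>2 / 8 * n \<le> card (N x - N v) \<and> \<epsilon>\<^sup>2 / 8 * n \<le> card (N v - N x)}"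
  have Z: "\<epsilon> / 2 * n \<le> card Z" using degv by (simp add: Z_def)
  then have Z0: "0 < real (card Z)" using n \<epsilon> by (smt (verit) divide_pos_pos mult_pos_pos of_nat_0_less_iff)
  have NZ: "{z\<in>Z. col z x} = N x - N v" if "x \<in> S" for x
    using that S T v sym by (auto simp: Z_def N_def subset_iff)
  have "\<epsilon> / 2 * n * card Z \<le> \<epsilon>\<^sup>2 / 8 * n * card S + card Z * card {x\<in>S. \<epsilon>\<^sup>2 / 8 * n \<le> card {z\<in>Z. col z x}}"
    using degT fin by (intro double_count) (auto simp: Z_def)
  also have "{x\<in>S. \<epsilon>\<^sup>2 / 8 * n \<le> card {z\<in>Z. col z x}} = Y" using NZ by (auto simp: Y_def)
  also have "\<epsilon>\<^sup>2 / 8 * n * card S \<le> \<epsilon>\<^sup>2 / 8 * n * n"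
    using card_mono[OF _ S] by (intro mult_left_mono) auto
  \<comment> \<open>The low-degree term is at most half of the left-hand side, which leaves
    \<open>card Y\<close> with the other half.\<close>
  also have "\<epsilon>\<^sup>2 / 8 * n * n = \<epsilon> / 4 * n * (\<epsilon> / 2 * n)" by (simp add: power2_eq_square)
  also have "\<dots> \<le> \<epsilon> / 4 * n * card Z" using Z \<epsilon> by (intro mult_left_mono) auto
  finally have "card Z * (\<epsilon> / 4 * n) \<le> card Z * real (card Y)" by (simp add: algebra_simps)
  then have "\<epsilon> / 4 * n \<le> card Y" using Z0 by simp
  moreover have "\<epsilon>\<^sup>2 \<le> \<epsilon>" using \<epsilon> by (simp add: power2_eq_square mult_left_le)
  then have "\<epsilon>\<^sup>2 / 4 * n \<le> \<epsilon> / 4 * n" by (intro mult_right_mono) auto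
  ultimately have Y: "\<epsilon>\<^sup>2 / 4 * n \<le> card Y" by linarith
  have "Y \<subseteq> G \<union> {x\<in>S. x \<noteq> v \<and> \<not> col v x} \<union> {x\<in>S. card (N v) < card (N x)}"
  proof
    fix x assume x: "x \<in> Y"
    have "0 < \<epsilon>\<^sup>2 / 8 * n" using n \<epsilon> by simp
    then have "x \<noteq> v" using x by (auto simp: Y_def)
    \<comment> \<open>Subtracting the common part from both sets turns the comparison of sizes into
      one of differences.\<close>
    moreover have "card (N x - N v) \<le> card (N v - N x)" if "card (N x) \<le> card (N v)"
      using that fin by (metis card_le_sym_Diff)
    then have "\<epsilon>\<^sup>2 / 8 * n \<le> card (N v - N x)" if "card (N x) \<le> card (N v)"
      using that x unfolding Y_def by (smt (verit) mem_Collect_eq of_nat_le_iff)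
    ultimately show "x \<in> G \<union> {x\<in>S. x \<noteq> v \<and> \<not> col v x} \<union> {x\<in>S. card (N v) < card (N x)}"
      using x by (auto simp: Y_def G_def not_less)
  qed
  then have "card Y \<le> card (G \<union> {x\<in>S. x \<noteq> v \<and> \<not> col v x} \<union> {x\<in>S. card (N v) < card (N x)})"
    using fin by (intro card_mono) (auto simp: G_def)
  also have "\<dots> \<le> card G + card {x\<in>S. x \<noteq> v \<and> \<not> col v x} + card {x\<in>S. card (N v) < card (N x)}"
    by (meson card_Un_le add_mono order_trans order_refl)
  finally have "\<epsilon>\<^sup>2 / 4 * n \<le> card G + \<delta> * n + \<delta> * n" using Y blue top by linarith
  moreover have "\<delta> * n \<le> \<epsilon>\<^sup>2 / 64 * n" using \<delta> by (intro mult_right_mono) auto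
  \<comment> \<open>In units of \<open>\<epsilon>\<^sup>2 / 64 * n\<close>: at least 16 in
    \<open>Y\<close>, at most 2 lost, 4 claimed.\<close>
  moreover have "\<epsilon>\<^sup>2 / 4 * n = 16 * (\<epsilon>\<^sup>2 / 64 * n)" "\<epsilon>\<^sup>2 / 16 * n = 4 * (\<epsilon>\<^sup>2 / 64 * n)" by simp_all
  moreover have "0 \<le> \<epsilon>\<^sup>2 / 64 * n" by simp
  ultimately have "\<epsilon>\<^sup>2 / 16 * n \<le> card G" by linarith
  then show ?thesis by (simp add: G_def)
qed

section \<open>The four cliques of alternative (ii)\<close>

definition crossing_cliques :: "nat \<Rightarrow> (nat \<Rightarrow> nat \<Rightarrow> bool) \<Rightarrow> nat \<Rightarrow> bool" where
  "crossing_cliques n col t \<longleftrightarrow>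
     (\<exists>V1 V2 V3 V4. V1 \<subseteq> {..<n} \<and> V2 \<subseteq> {..<n} \<and> V3 \<subseteq> {..<n} \<and> V4 \<subseteq> {..<n} \<and>
        V1 \<inter> V2 = {} \<and> V1 \<inter> V3 = {} \<and> V1 \<inter> V4 = {} \<and> V2 \<inter> V3 = {} \<and> V2 \<inter> V4 = {} \<and> V3 \<inter> V4 = {} \<and>
        card V1 = t \<and> card V2 = t \<and> card V3 = t \<and> card V4 = t \<and>
        mono_in col True V1 \<and> mono_in col True V4 \<and>
        mono_btw col True V1 V3 \<and> mono_btw col True V1 V4 \<and> mono_btw col True V2 V4 \<and>
        mono_in col False V2 \<and> mono_in col False V3 \<and>
        mono_btw col False V1 V2 \<and> mono_btw col False V2 V3 \<and> mono_btw col False V3 V4)"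

text \<open>A single index set, a red clique \<open>K4\<close> in \<open>R\<close>, is thinned to
  \<open>I\<close>, \<open>J\<close> and \<open>L\<close>. Each index \<open>j\<close> carries a
  partner \<open>g j\<close> in \<open>R\<close> and a partner \<open>h j\<close> in
  \<open>B\<close>. In the end \<open>V4\<close> is a part of \<open>L\<close>, \<open>V1\<close>
  and \<open>V3\<close> are its images under \<open>g\<close> and \<open>h\<close>, and
  \<open>V2\<close> is taken from the last clique found.\<close>

lemma crossing_cliques_of_rich_partition:
  fixes \<epsilon> \<delta> :: real
  assumes sym: "\<And>x y. x < n \<Longrightarrow> y < n \<Longrightarrow> col x y = col y x"
    and bal: "locally_balanced \<epsilon> n col" and \<epsilon>: "0 < \<epsilon>" "\<epsilon> \<le> 1"
    and \<delta>_def: "\<delta> = \<epsilon>\<^sup>2 / 64"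
    and part: "R \<union> B = {..<n}" "R \<inter> B = {}"
    and rich: "rich col True m M R" "rich col False m M B"
    and M: "1 \<le> M" and t: "1 \<le> t" and m: "2 ^ 14 * real t \<le> \<epsilon> ^ 6 * m"
    and n: "2 ^ (m + 1) * real M \<le> \<delta> * n"
    and no: "\<not> opposite_cliques n col True t" "\<not> opposite_cliques n col False t"
  shows "crossing_cliques n col t"
proof -
  have sub: "R \<subseteq> {..<n}" "B \<subseteq> {..<n}" using part by auto
  then have fin: "finite R" "finite B" by (simp_all add: finite_subset[OF _ finite_lessThan])
  have \<delta>: "0 < \<delta>" "64 * \<delta> \<le> \<epsilon>\<^sup>2" using \<epsilon> by (auto simp: \<delta>_def)
  have e: "\<epsilon>\<^sup>2 \<le> \<epsilon>" "\<epsilon> ^ 6 \<le> 1" "\<epsilon> ^ 6 \<le> \<epsilon>\<^sup>2"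
    using \<epsilon> power_decreasing[of 1 2 \<epsilon>] power_decreasing[of 2 6 \<epsilon>] power_le_one[of \<epsilon> 6] by auto
  have "2 ^ 14 * real t \<le> m" "2 ^ 14 * real t \<le> \<epsilon>\<^sup>2 * m"
    using m e mult_right_mono[OF e(2), of m] mult_right_mono[OF e(3), of m] by linarith+
  then have tm: "t \<le> m" "t \<le> \<delta> * m / 2" using t by (auto simp: \<delta>_def)
  have "real M \<le> 2 ^ (m + 1) * real M" 
    using mult_right_mono[of 1 "2 ^ (m + 1)" "real M"] one_le_power[of "2::real" "m + 1"] by simp
  then have Mn: "M \<le> \<delta> * n" using n by linarith
  then have n0: "0 < n" using M by (cases n) auto

  define Rs where "Rs = {r\<in>R. card {x\<in>R. x \<noteq> r \<and> \<not> col r x} \<le> \<delta> * n}"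
  define Bs where "Bs = {b\<in>B. card {x\<in>B. x \<noteq> b \<and> col b x} \<le> \<delta> * n}"
  have "R - Rs = {r\<in>R. \<delta> * n < card {x\<in>R. x \<noteq> r \<and> \<not> col r x}}"
    "B - Bs = {r\<in>B. \<delta> * n < card {x\<in>B. x \<noteq> r \<and> col r x}}" by (auto simp: Rs_def Bs_def)
  then have "card (R - Rs) < M" "card (B - Bs) < M"
    using few_exceptional[OF sub(1) rich(1) M t tm(2,1) \<delta>(1) n no(1)]
      few_exceptional[OF sub(2) rich(2) M t tm(2,1) \<delta>(1) n no(2)] by simp_all
  then have few: "card (R - Rs) \<le> \<delta> * n" "card (B - Bs) \<le> \<delta> * n" using Mn by linarith+
  have RBs: "Rs \<subseteq> R" "Bs \<subseteq> B" "Rs \<subseteq> {..<n}" "Bs \<subseteq> {..<n}" "finite Rs" "finite Bs"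
    using sub fin by (auto simp: Rs_def Bs_def)
  have richs: "rich col True m M Rs" "rich col False m M Bs" using rich RBs rich_subset by blast+
  have "4 * \<delta> \<le> \<epsilon>" using e \<epsilon> by (simp add: \<delta>_def)
  have degR: "\<epsilon> / 2 * n \<le> card {b\<in>Bs. \<not> col r b}" if "r \<in> Rs" for r
    using large_cross_degree[of R B n r Bs \<epsilon> col False \<delta>] part bal that few RBs \<open>4 * \<delta> \<le> \<epsilon>\<close>
    by (auto simp: locally_balanced_def blue_deg_def Rs_def)
  have degB: "\<epsilon> / 2 * n \<le> card {r\<in>Rs. col b r}" if "b \<in> Bs" for b
    using large_cross_degree[of B R n b Rs \<epsilon> col True \<delta>] part bal that few RBs \<open>4 * \<delta> \<le> \<epsilon>\<close>
    by (auto simp: locally_balanced_def red_deg_def Bs_def)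
  \<comment> \<open>If \<open>Rs\<close> were empty, the cross degrees would force \<open>Bs\<close>
    to be empty too, and nearly all vertices would be exceptional. A vertex of \<open>Rs\<close> has
    a neighbour in \<open>Bs\<close>, whose red neighbours in \<open>Rs\<close> then number at least
    \<open>M\<close>.\<close>
  have "M \<le> card Rs"
  proof -
    have "Rs \<noteq> {}"
    proof
      assume *: "Rs = {}"
      then have "Bs = {}" using degB \<epsilon> n0 by (force simp: mult_le_0_iff)
      have "n = card (R \<union> B)" by (simp add: part)
      also have "\<dots> \<le> card R + card B" by (rule card_Un_le)
      finally have "real n \<le> \<delta> * n + \<delta> * n" using few * \<open>Bs = {}\<close> by simp
      moreover have "4 * \<delta> * n \<le> 1 * real n" using \<open>4 * \<delta> \<le> \<epsilon>\<close> \<epsilon> by (intro mult_right_mono) auto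
      ultimately show False using n0 by simp
    qed
    then obtain r where "r \<in> Rs" by blast
    then have "Bs \<noteq> {}" using degR[of r] \<epsilon> n0 by (force simp: mult_le_0_iff)
    then obtain b where "b \<in> Bs" by blast
    have "M \<le> \<delta> * n" by (rule Mn)
    also have "\<dots> \<le> \<epsilon> / 2 * n" using \<open>4 * \<delta> \<le> \<epsilon>\<close> \<delta> by (intro mult_right_mono) auto
    also have "\<dots> \<le> card {r\<in>Rs. col b r}" by (rule degB) fact
    also have "\<dots> \<le> card Rs" using RBs by (simp add: card_mono)
    finally show ?thesis by simp
  qed

  define N where "N r = {b\<in>Bs. col r b}" for r
  obtain D where D: "M \<le> card {x\<in>Rs. D \<le> card (N x)}" "card {x\<in>Rs. D < card (N x)} < M"
    by (rule top_set[OF RBs(5) \<open>M \<le> card Rs\<close> M, of "\<lambda>x. card (N x)"])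
  have "has_clique col True m {x\<in>Rs. D \<le> card (N x)}" using richs(1) D(1) by (auto simp: rich_def)
  then obtain K4 where K4: "K4 \<subseteq> Rs" "\<And>v. v \<in> K4 \<Longrightarrow> D \<le> card (N v)" "card K4 = m" "mono_in col True K4"
    by (auto simp: has_clique_def)
  have m0: "m > 0" using t tm by simp
  have finK4: "finite K4" "K4 \<noteq> {}" using K4 m0 by (auto intro: card_ge_0_finite)

  \<comment> \<open>The two large differences provide the candidates for \<open>V3\<close> and
    \<open>V2\<close>, respectively.\<close>
  define P where "P v x \<longleftrightarrow> x \<noteq> v \<and> col v x \<and>
    \<epsilon>\<^sup>2 / 8 * n \<le> card (N x - N v) \<and> \<epsilon>\<^sup>2 / 8 * n \<le> card (N v - N x)" for v x
  have "\<epsilon>\<^sup>2 / 16 * n \<le> card {x\<in>Rs. P v x}" if v: "v \<in> K4" for v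
    unfolding P_def N_def
  proof (rule many_crossing_pairs[OF RBs(3,4) _ sym n0 \<epsilon> \<delta>(2) degR degB])
    have vR: "v \<in> Rs" using v K4 by blast
    then have "card {x\<in>Rs. x \<noteq> v \<and> \<not> col v x} \<le> card {x\<in>R. x \<noteq> v \<and> \<not> col v x}"
      using RBs fin by (intro card_mono) auto
    then show "card {x\<in>Rs. x \<noteq> v \<and> \<not> col v x} \<le> \<delta> * n" using vR by (simp add: Rs_def)
    have "card {x\<in>Rs. card (N v) < card (N x)} \<le> card {x\<in>Rs. D < card (N x)}"
      using K4(2)[OF v] RBs by (intro card_mono) auto
    then show "card {x\<in>Rs. card {b\<in>Bs. col v b} < card {b\<in>Bs. col x b}} \<le> \<delta> * n"
      using D(2) Mn unfolding N_def by linarith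
  qed (use v K4 in auto)
  then obtain I K1 where I: "I \<subseteq> K4" "\<epsilon>\<^sup>2 / 16 * card K4 / 2 \<le> card I"
      and K1: "K1 \<subseteq> Rs" "card K1 = m" "mono_in col True K1" "\<And>i x. i \<in> I \<Longrightarrow> x \<in> K1 \<Longrightarrow> P i x"
    using rich_extension[of K4 m Rs n col True M \<delta> "\<epsilon>\<^sup>2 / 16" P] finK4 K4(3) RBs richs M \<delta> n
    by (auto simp del: power_Suc)
  have finI: "finite I" "card I \<le> m" using I finK4 K4 card_mono finite_subset by metis+
  have "0 < real (card I)" using I(2) K4(3) m0 \<epsilon> by (smt (verit) divide_pos_pos mult_pos_pos of_nat_0_less_iff zero_less_power)
  then have "I \<noteq> {}" by auto
  have "finite K1" using K1 m0 by (auto intro: card_ge_0_finite)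
  \<comment> \<open>As \<open>P\<close> holds between all of \<open>I\<close> and all of
    \<open>K1\<close>, any injection is a valid choice of partners; injectivity keeps the image of
    \<open>V4\<close> at size \<open>t\<close>.\<close>
  then obtain g where g: "g ` I \<subseteq> K1" "inj_on g I" using card_le_inj[of I K1] finI K1 by auto

  have "\<epsilon>\<^sup>2 / 8 * n \<le> card {b\<in>Bs. col (g i) b \<and> \<not> col i b}" if "i \<in> I" for i
  proof -
    have "P i (g i)" using that g K1 by blast
    moreover have "N (g i) - N i = {b\<in>Bs. col (g i) b \<and> \<not> col i b}" by (auto simp: N_def)
    ultimately show ?thesis by (simp add: P_def)
  qed
  then obtain J K3 where J: "J \<subseteq> I" "\<epsilon>\<^sup>2 / 8 * card I / 2 \<le> card J"
      and K3: "K3 \<subseteq> Bs" "card K3 = m" "mono_in col False K3"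
        "\<And>i b. i \<in> J \<Longrightarrow> b \<in> K3 \<Longrightarrow> col (g i) b \<and> \<not> col i b"
    using rich_extension[of I m Bs n col False M \<delta> "\<epsilon>\<^sup>2 / 8" "\<lambda>i b. col (g i) b \<and> \<not> col i b"]
      finI \<open>I \<noteq> {}\<close> RBs richs M \<delta> n by (auto simp del: power_Suc)
  have finJ: "finite J" "card J \<le> m" using J finI card_mono[OF finI(1) J(1)] finite_subset by auto
  have "0 < real (card J)" using J(2) \<open>0 < real (card I)\<close> \<epsilon> by (smt (verit) divide_pos_pos mult_pos_pos zero_less_power)
  then have "J \<noteq> {}" by auto
  have "finite K3" using K3 m0 by (auto intro: card_ge_0_finite)
  then obtain h where h: "h ` J \<subseteq> K3" "inj_on h J" using card_le_inj[of J K3] finJ K3 by auto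

  \<comment> \<open>The candidates come from \<open>N j - N (g j)\<close>. Being blue to
    \<open>h j\<close> costs at most \<open>\<delta> * n\<close> of them because \<open>h j\<close>
    is in \<open>Bs\<close>; \<open>b \<noteq> h j\<close> makes \<open>V2\<close> and
    \<open>V3\<close> disjoint.\<close>
  define Q where "Q j b \<longleftrightarrow> col j b \<and> \<not> col (g j) b \<and> b \<noteq> h j \<and> \<not> col (h j) b" for j b
  have "\<epsilon>\<^sup>2 / 16 * n \<le> card {b\<in>Bs. Q j b}" if j: "j \<in> J" for j
  proof -
    have "P j (g j)" using j J g K1 by blast
    have hj: "h j \<in> Bs" "h j \<in> K3" using j h K3 by auto
    have "N j - N (g j) \<subseteq> {b\<in>Bs. Q j b} \<union> {x\<in>B. x \<noteq> h j \<and> col (h j) x}"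
      using K3(4)[OF j hj(2)] RBs by (auto simp: N_def Q_def)
    then have "card (N j - N (g j)) \<le> card ({b\<in>Bs. Q j b} \<union> {x\<in>B. x \<noteq> h j \<and> col (h j) x})"
      using RBs fin by (intro card_mono) auto
    also have "\<dots> \<le> card {b\<in>Bs. Q j b} + card {x\<in>B. x \<noteq> h j \<and> col (h j) x}" by (rule card_Un_le)
    finally have "\<epsilon>\<^sup>2 / 8 * n \<le> card {b\<in>Bs. Q j b} + \<delta> * n"
      using \<open>P j (g j)\<close> hj(1) unfolding P_def Bs_def by simp
    moreover have "\<delta> * n \<le> \<epsilon>\<^sup>2 / 64 * n" using \<delta> by (intro mult_right_mono) auto
    ultimately show ?thesis by (auto simp: field_simps)
  qed
  then obtain L K2 where L: "L \<subseteq> J" "\<epsilon>\<^sup>2 / 16 * card J / 2 \<le> card L"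
      and K2: "K2 \<subseteq> Bs" "card K2 = m" "mono_in col False K2" "\<And>j b. j \<in> L \<Longrightarrow> b \<in> K2 \<Longrightarrow> Q j b"
    using rich_extension[of J m Bs n col False M \<delta> "\<epsilon>\<^sup>2 / 16" Q] finJ \<open>J \<noteq> {}\<close> RBs richs M \<delta> n
    by (auto simp del: power_Suc)

  \<comment> \<open>The three shrinking factors multiply to \<open>\<epsilon> ^ 6 / 2 ^ 14\<close>,
    whence the assumption on \<open>m\<close>.\<close>
  have "\<epsilon> ^ 6 * m / 2 ^ 14 = \<epsilon>\<^sup>2 / 32 * (\<epsilon>\<^sup>2 / 16 * (\<epsilon>\<^sup>2 / 32 * m))"
    by (simp add: field_simps flip: power_add)
  also have "\<dots> \<le> \<epsilon>\<^sup>2 / 32 * (\<epsilon>\<^sup>2 / 16 * card I)"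
    using I(2) K4(3) by (intro mult_left_mono) auto
  also have "\<dots> \<le> \<epsilon>\<^sup>2 / 32 * card J" using J(2) by (intro mult_left_mono) auto
  also have "\<dots> \<le> card L" using L(2) by simp
  finally have "t \<le> card L" using m by simp
  then obtain V4 where V4: "V4 \<subseteq> L" "card V4 = t" by (meson obtain_subset_with_card_n)
  obtain V2 where V2: "V2 \<subseteq> K2" "card V2 = t" using tm K2 by (metis obtain_subset_with_card_n)
  have sub4: "V4 \<subseteq> J" "V4 \<subseteq> I" "V4 \<subseteq> K4" "V4 \<subseteq> Rs" using V4 L J I K4 by auto
  define V1 V3 where "V1 = g ` V4" and "V3 = h ` V4"
  have sub1: "V1 \<subseteq> K1" "V1 \<subseteq> Rs" using g(1) sub4(2) K1(1) by (auto simp: V1_def)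
  have sub3: "V3 \<subseteq> K3" "V3 \<subseteq> Bs" using h(1) sub4(1) K3(1) by (auto simp: V3_def)
  have sub2: "V2 \<subseteq> Bs" using V2 K2 by auto
  have disj: "Rs \<inter> Bs = {}" using part RBs by blast
  have pP: "P i x" if "i \<in> V4" "x \<in> V1" for i x using that sub4 sub1 K1(4) by blast
  have p3: "col (g i) b \<and> \<not> col i b" if "i \<in> V4" "b \<in> V3" for i b
    using that sub4 sub3 K3(4) by blast
  have pQ: "Q j b" if "j \<in> V4" "b \<in> V2" for j b using that V4 V2 K2(4) by blast
  have sym': "col x y = col y x" if "x \<in> Rs \<union> Bs" "y \<in> Rs \<union> Bs" for x y
    using that RBs(3,4) by (intro sym) auto
  show ?thesis
    unfolding crossing_cliques_def
  proof (rule exI[of _ V1], rule exI[of _ V2], rule exI[of _ V3], rule exI[of _ V4], intro conjI)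
    show "V1 \<subseteq> {..<n}" "V2 \<subseteq> {..<n}" "V3 \<subseteq> {..<n}" "V4 \<subseteq> {..<n}"
      using sub1(2) sub2 sub3(2) sub4(4) RBs(3,4) by auto
    show "V1 \<inter> V2 = {}" "V1 \<inter> V3 = {}" "V2 \<inter> V4 = {}" "V3 \<inter> V4 = {}"
      using sub1(2) sub2 sub3(2) sub4(4) disj by auto
    show "V1 \<inter> V4 = {}" using pP unfolding P_def by blast
    show "V2 \<inter> V3 = {}" using pQ by (auto simp: Q_def V3_def)
    show "card V1 = t" "card V3 = t"
      using V4(2) card_image inj_on_subset[OF g(2) sub4(2)] inj_on_subset[OF h(2) sub4(1)]
      by (auto simp: V1_def V3_def)
    show "mono_in col True V1" "mono_in col True V4" "mono_in col False V2" "mono_in col False V3"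
      using mono_in_subset[OF K1(3) sub1(1)] mono_in_subset[OF K4(4) sub4(3)]
        mono_in_subset[OF K2(3) V2(1)] mono_in_subset[OF K3(3) sub3(1)] by auto
    show "mono_btw col True V1 V3" using p3 by (auto simp: mono_btw_def V1_def)
    show "mono_btw col True V1 V4" unfolding mono_btw_def
      using pP sym' sub1 sub4 unfolding P_def by (metis Un_iff subsetD)
    show "mono_btw col True V2 V4" unfolding mono_btw_def
      using pQ sym' sub2 sub4 unfolding Q_def by (metis Un_iff subsetD)
    show "mono_btw col False V1 V2" using pQ by (auto simp: mono_btw_def Q_def V1_def)
    show "mono_btw col False V2 V3" unfolding mono_btw_def
    proof (intro ballI)
      fix x y assume xy: "x \<in> V2" "y \<in> V3"
      then have "\<not> col y x" using pQ by (auto simp: Q_def V3_def)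
      then show "col x y = False" using sym'[of x y] xy sub2 sub3 by blast
    qed
    show "mono_btw col False V3 V4" unfolding mono_btw_def
      using p3 sym' sub3 sub4 by (metis Un_iff subsetD)
  qed (use V2 V4 in auto)
qed

section \<open>Choice of parameters\<close>

text \<open>\<open>M\<close> is about \<open>sqrt n * 2 ^ m\<close>, the least order allowed by the
  quadratic condition. Then \<open>2 ^ m * M\<close> is about \<open>4 ^ m * sqrt n\<close>, far
  below \<open>n\<close> because \<open>sqrt n\<close> is at least
  \<open>2 ^ (4 * m)\<close>.\<close>

lemma sqrt_threshold:
  fixes \<epsilon> :: real
  assumes \<epsilon>: "0 < \<epsilon>" "\<epsilon> \<le> 1" and m: "2 ^ 14 \<le> \<epsilon> ^ 6 * m" and n: "2 ^ (8 * m) \<le> real n"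
  obtains M :: nat where "1 \<le> M" "M + n * 4 ^ m \<le> M * M" "2 ^ (m + 1) * real M \<le> \<epsilon>\<^sup>2 / 64 * n"
proof -
  define x where "x = sqrt n * 2 ^ m"
  \<comment> \<open>The extra 1 gives \<open>x + 1 \<le> M\<close>, which absorbs the summand
    \<open>M\<close> in \<open>M + x * x \<le> M * (x + 1)\<close>.\<close>
  define M where "M = nat \<lceil>x\<rceil> + 1"
  have "\<epsilon> ^ 6 \<le> 1" "\<epsilon> ^ 6 \<le> \<epsilon>\<^sup>2"
    using \<epsilon> power_decreasing[of 2 6 \<epsilon>] power_le_one[of \<epsilon> 6] by auto
  from this[THEN mult_right_mono, of "real m"]
  have "\<epsilon> ^ 6 * m \<le> m" "\<epsilon> ^ 6 * m \<le> \<epsilon>\<^sup>2 * m" by simp_all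
  then have m1: "2 ^ 14 \<le> real m" "1 \<le> \<epsilon>\<^sup>2 * m"
    using m one_le_power[of "2::real" 14] by linarith+
  have s: "2 ^ (4 * m) \<le> sqrt n"
    using n by (intro real_le_rsqrt) (simp flip: power_mult)
  have s1: "1 \<le> sqrt n" using s one_le_power[of "2::real" "4 * m"] by linarith
  have x1: "1 \<le> x" unfolding x_def using s1 mult_mono[of 1 "sqrt n" 1 "2 ^ m"] by simp
  have M: "x + 1 \<le> M" "M \<le> x + 2" using x1 by (auto simp: M_def, linarith+)
  have "(2::real) ^ m * 2 ^ m = 4 ^ m" by (simp flip: power_mult_distrib)
  moreover have "x * x = sqrt n * sqrt n * (2 ^ m * 2 ^ m)" by (simp only: x_def mult_ac)
  moreover have "sqrt n * sqrt n = n" by simp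
  ultimately have "real (M + n * 4 ^ m) = M + x * x"
    by (simp only: of_nat_add of_nat_mult of_nat_power of_nat_numeral)
  also have "\<dots> \<le> M + M * x" using M x1 by (intro add_left_mono mult_right_mono) auto
  also have "\<dots> = M * (x + 1)" by (simp add: algebra_simps)
  also have "\<dots> \<le> M * real M" using M by (intro mult_left_mono) auto
  finally have "M + n * 4 ^ m \<le> M * M" by (metis of_nat_mult of_nat_le_iff)
  moreover have "2 ^ (m + 1) * real M \<le> \<epsilon>\<^sup>2 / 64 * n"
  proof -
    have "real m \<le> 2 ^ m" using of_nat_less_two_power[of m, where 'a = real] by simp
    then have em: "1 \<le> \<epsilon>\<^sup>2 * 2 ^ m" using m1 mult_left_mono[of "real m" "2 ^ m" "\<epsilon>\<^sup>2"] by simp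
    have "9 \<le> m" using m1 by simp
    \<comment> \<open>Here \<open>M \<le> x + 2\<close> is weakened to \<open>4 * x\<close>. Of the
      room up to \<open>2 ^ (4 * m)\<close>, one factor \<open>2 ^ m\<close> pays for the constant
      \<open>2 ^ 9\<close> and another for \<open>\<epsilon>\<^sup>2\<close>.\<close>
    have "64 * (2 ^ (m + 1) * real M) \<le> 64 * (2 ^ (m + 1) * (4 * x))"
      using M x1 by (intro mult_left_mono) auto
    also have "\<dots> = 2 ^ (2 * m + 9) * sqrt n" by (simp add: x_def power_add power_even_eq power2_eq_square)
    also have "\<dots> \<le> 2 ^ (3 * m) * sqrt n" using \<open>9 \<le> m\<close> by (intro mult_right_mono power_increasing) auto
    also have "\<dots> \<le> (\<epsilon>\<^sup>2 * 2 ^ m) * (2 ^ (3 * m) * sqrt n)" 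
      using mult_right_mono[OF em, of "2 ^ (3 * m) * sqrt n"] by (simp only: mult_1) simp
    also have "\<dots> = \<epsilon>\<^sup>2 * (2 ^ (4 * m) * sqrt n)" by (simp flip: power_add)
    also have "\<dots> \<le> \<epsilon>\<^sup>2 * (sqrt n * sqrt n)" using s by (intro mult_left_mono mult_right_mono) auto
    finally show ?thesis by simp
  qed
  ultimately show ?thesis using that[of M] by (simp add: M_def)
qed

lemma opposite_or_crossing_cliques:
  fixes \<epsilon> :: real
  assumes \<epsilon>: "0 < \<epsilon>" and t: "1 \<le> t" and n: "2 powr (2 ^ 18 * real t / \<epsilon> ^ 16) \<le> real n"
    and col: "colouring n col" and bal: "locally_balanced \<epsilon> n col"
  shows "(\<exists>c. opposite_cliques n col c t) \<or> crossing_cliques n col t"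
proof (rule disjCI)
  assume "\<not> crossing_cliques n col t"
  have "0 < real n" using n by (rule less_le_trans[rotated]) simp
  then have n0: "0 < n" by simp
  \<comment> \<open>A degree is at most \<open>n\<close>, so local balance forces
    \<open>\<epsilon> \<le> 1\<close>.\<close>
  have "\<epsilon> * n \<le> red_deg n col 0" using bal n0 by (simp add: locally_balanced_def)
  also have "red_deg n col 0 \<le> card {..<n}" unfolding red_deg_def by (intro card_mono) auto
  finally have "\<epsilon> * n \<le> 1 * n" by simp
  then have \<epsilon>1: "\<epsilon> \<le> 1" using n0 by simp
  define y where "y = 2 ^ 14 * real t / \<epsilon> ^ 6"
  define m where "m = nat \<lceil>y\<rceil>"
  have "\<epsilon> ^ 6 \<le> 1" "\<epsilon> ^ 16 \<le> \<epsilon> ^ 6"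
    using \<epsilon> \<epsilon>1 power_le_one[of \<epsilon> 6] power_decreasing[of 6 16 \<epsilon>] by auto
  then have y: "1 \<le> y" "8 * (2 * y) \<le> 2 ^ 18 * real t / \<epsilon> ^ 16"
    unfolding y_def using \<epsilon> t frac_le[of "2 ^ 18 * real t" "2 ^ 18 * real t" "\<epsilon> ^ 16" "\<epsilon> ^ 6"]
    by (auto simp: le_divide_eq)
  \<comment> \<open>Rounding up at most doubles \<open>y\<close>, since
    \<open>1 \<le> y\<close>.\<close>
  have m: "y \<le> m" "m \<le> 2 * y" using y by (auto simp: m_def, linarith+)
  have "2 ^ 14 * real t \<le> \<epsilon> ^ 6 * m" using m(1) \<epsilon> by (simp add: y_def field_simps)
  moreover have "2 ^ (8 * m) \<le> real n"
  proof -
    have "(2::real) ^ (8 * m) = 2 powr (8 * m)" by (simp add: powr_realpow flip: of_nat_mult)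
    also have "\<dots> \<le> 2 powr (2 ^ 18 * real t / \<epsilon> ^ 16)" using m y by (intro powr_mono) auto
    also have "\<dots> \<le> n" by (rule n)
    finally show ?thesis .
  qed
  ultimately have tm: "2 ^ 14 * real t \<le> \<epsilon> ^ 6 * m" "2 ^ 14 \<le> \<epsilon> ^ 6 * m" "2 ^ (8 * m) \<le> real n"
    using t by auto
  obtain M where M: "1 \<le> M" "M + n * 4 ^ m \<le> M * M" "2 ^ (m + 1) * real M \<le> \<epsilon>\<^sup>2 / 64 * n"
    using sqrt_threshold[OF \<epsilon> \<epsilon>1 tm(2,3)] .
  have sym: "col x y = col y x" if "x < n" "y < n" for x y using that col by (simp add: colouring_def)
  obtain R B where RB: "{..<n} = R \<union> B" "R \<inter> B = {}" "rich col True m M R" "rich col False m M B"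
    using rich_partition[of "{..<n}" col M m] sym M by auto
  show "\<exists>c. opposite_cliques n col c t"
    using crossing_cliques_of_rich_partition[OF sym bal \<epsilon> \<epsilon>1 refl RB(1)[symmetric] RB(2-4) M(1) t tm(1) M(3)]
      \<open>\<not> crossing_cliques n col t\<close> by blast
qed

theorem theorem1p4:
  shows "\<exists>C::real>0. \<forall>\<epsilon>::real>0. \<forall>t::nat\<ge>1. \<forall>n::nat. \<forall>col.
    real n \<ge> 2 powr (C * real t / \<epsilon> ^ 16) \<longrightarrow> colouring n col \<longrightarrow> locally_balanced \<epsilon> n col \<longrightarrow>
    ((\<exists>A B c. A \<subseteq> {..<n} \<and> B \<subseteq> {..<n} \<and> A \<inter> B = {} \<and> card A = t \<and> card B = t \<and>
        mono_in col c A \<and> mono_in col c B \<and> mono_btw col (\<not> c) A B)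
     \<or> (\<exists>V1 V2 V3 V4. V1 \<subseteq> {..<n} \<and> V2 \<subseteq> {..<n} \<and> V3 \<subseteq> {..<n} \<and> V4 \<subseteq> {..<n} \<and>
        V1 \<inter> V2 = {} \<and> V1 \<inter> V3 = {} \<and> V1 \<inter> V4 = {} \<and> V2 \<inter> V3 = {} \<and> V2 \<inter> V4 = {} \<and> V3 \<inter> V4 = {} \<and>
        card V1 = t \<and> card V2 = t \<and> card V3 = t \<and> card V4 = t \<and>
        mono_in col True V1 \<and> mono_in col True V4 \<and>
        mono_btw col True V1 V3 \<and> mono_btw col True V1 V4 \<and> mono_btw col True V2 V4 \<and>
        mono_in col False V2 \<and> mono_in col False V3 \<and>
        mono_btw col False V1 V2 \<and> mono_btw col False V2 V3 \<and> mono_btw col False V3 V4))"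
\<comment> \<open>The constant is \<open>2 ^ 14\<close> from the shrinking factors, times 2 for
  rounding \<open>m\<close> up, times 8 for \<open>2 ^ (8 * m) \<le> n\<close>.\<close>
proof (intro exI[of _ "2 ^ 18"] conjI allI impI)
  fix \<epsilon> :: real and t n :: nat and col
  assume "0 < \<epsilon>" "1 \<le> t" "2 powr (2 ^ 18 * real t / \<epsilon> ^ 16) \<le> real n"
    "colouring n col" "locally_balanced \<epsilon> n col"
  from opposite_or_crossing_cliques[OF this]
  show "(\<exists>A B c. A \<subseteq> {..<n} \<and> B \<subseteq> {..<n} \<and> A \<inter> B = {} \<and> card A = t \<and> card B = t \<and>
        mono_in col c A \<and> mono_in col c B \<and> mono_btw col (\<not> c) A B)
     \<or> (\<exists>V1 V2 V3 V4. V1 \<subseteq> {..<n} \<and> V2 \<subseteq> {..<n} \<and> V3 \<subseteq> {..<n} \<and> V4 \<subseteq> {..<n} \<and>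
        V1 \<inter> V2 = {} \<and> V1 \<inter> V3 = {} \<and> V1 \<inter> V4 = {} \<and> V2 \<inter> V3 = {} \<and> V2 \<inter> V4 = {} \<and> V3 \<inter> V4 = {} \<and>
        card V1 = t \<and> card V2 = t \<and> card V3 = t \<and> card V4 = t \<and>
        mono_in col True V1 \<and> mono_in col True V4 \<and>
        mono_btw col True V1 V3 \<and> mono_btw col True V1 V4 \<and> mono_btw col True V2 V4 \<and>
        mono_in col False V2 \<and> mono_in col False V3 \<and>
        mono_btw col False V1 V2 \<and> mono_btw col False V2 V3 \<and> mono_btw col False V3 V4)"
    unfolding opposite_cliques_def crossing_cliques_def by (elim disjE) blast+
qed simp

end
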